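(* Let $p\in[0,1]$ and let $n$ be a positive integer. If $p=0$ or $p=1$, then $\max_{m\ge 1}|\min(\mathcal B_{n,m,p})|=1$. If $0<p<1$ (a constant), then, as $n\to\infty$, $$\max_{m\ge 1}\ \mathbb E[\,|\min(\mathcal B_{n,m,p})|\,]=\Theta\!\left((1+p)^n/\sqrt n\right),$$ and the maximum is attained for $m=1/(1-p)^{\frac{n}{1+p}}$.
   Context: For a probability $p$ and positive integers $n,m$, the random multi-hypergraph $\mathcal B_{n,m,p}$ on vertex set $[n]=\{1,\dots,n\}$ is obtained by independently sampling $m$ (not necessarily distinct) subsets of $[n]$, where each subset is generated by including each vertex independently with probability $p$; the $m$ samples form the edges (a multiset). The minimization $\min(\mathcal H)$ of a multi-hypergraph $\mathcal H$ is the set of its inclusion-wise minimal edges, a minimal edge with several copies being counted only once.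
   Formalization: "The maximum is attained for m=1/(1-p)^{n/(1+p)}" is proved up to constant factors, with m rounded up or down: the expectation there is Θ of the maximum. Exact attainment fails: p=1/2, n=3 gives m=4 with value 1.494, but m=5 gives 1.506; m is also usually not an integer. *)

theory Defs
  imports "HOL-Probability.Probability" "HOL-Library.Landau_Symbols" "HOL-Library.Multiset"
begin

definition random_edge :: "nat \<Rightarrow> real \<Rightarrow> nat set pmf" where
  "random_edge n p =
     map_pmf (\<lambda>f. {v \<in> {1..n}. f v}) (Pi_pmf {1..n} False (\<lambda>_. bernoulli_pmf p))"

definition random_multi_hypergraph :: "nat \<Rightarrow> nat \<Rightarrow> real \<Rightarrow> nat set multiset pmf" where
  "random_multi_hypergraph n m p = map_pmf mset (replicate_pmf m (random_edge n p))"

definition minimization :: "'a set multiset \<Rightarrow> 'a set set" where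
  "minimization H = {e \<in> set_mset H. \<not> (\<exists>f \<in> set_mset H. f \<subset> e)}"

definition expected_min_size :: "nat \<Rightarrow> nat \<Rightarrow> real \<Rightarrow> real" where
  "expected_min_size n m p =
     measure_pmf.expectation (random_multi_hypergraph n m p) (\<lambda>H. real (card (minimization H)))"

text \<open>
  \<^const>\<open>Max\<close> is only meaningful on finite sets, whereas the maxima here range over all
  \<open>m \<ge> 1\<close>.
\<close>

definition is_maximum :: "'a::linorder set \<Rightarrow> 'a \<Rightarrow> bool" where
  "is_maximum S x \<longleftrightarrow> x \<in> S \<and> (\<forall>y\<in>S. y \<le> x)"

definition critical_m :: "nat \<Rightarrow> real \<Rightarrow> real" where
  "critical_m n p = 1 / (1 - p) powr (real n / (1 + p))"

end

theory Submission
  imports Defs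
begin

text \<open>
  Write \<open>q = 1 - p\<close>. A set of size \<open>i\<close> is a minimal edge iff some sample equals it and no sample is
  a proper subset, so
  \<open>E n m = (\<Sum>i\<le>n. (n choose i) * ((1 - q^(n-i) * (1 - p^i))^m - (1 - q^(n-i))^m))\<close>.
  As \<open>m \<rightarrow> \<infinity>\<close> this tends to 1, which is also its value at \<open>m = 1\<close>; hence the maximum is attained.
  For \<open>i \<ge> 1\<close> the \<open>i\<close>-th term is at most a constant times \<open>(n choose i) * p^i * \<phi> (m * q^(n-i))\<close> with
  \<open>\<phi> x = min x (1/x)\<close>. The arguments of \<open>\<phi>\<close> form a geometric progression, so the values of \<open>\<phi>\<close> have
  a bounded sum and \<open>E n m\<close> is \<open>O (max\<^sub>i (n choose i) * p^i)\<close>. Conversely, the single term at the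
  maximising \<open>i \<approx> n * p / (1 + p)\<close> already has this order when \<open>m * q^(n-i)\<close> is bounded away from
  0 and infinity, that is, for \<open>m\<close> near \<open>q powr (- n / (1 + p))\<close>. Finally \<open>(n choose i) * p^i\<close> is
  \<open>(1 + p)^n\<close> times a binomial probability with parameter \<open>p / (1 + p)\<close>, whose mode has mass of
  order \<open>1 / \<surd>n\<close>.
\<close>

section \<open>The expected number of minimal edges\<close>

text \<open>Supports are countable and carry all the mass, so intersecting with them reduces the
  claim to the product rule for countable sets.\<close>

lemma prob_pair_pmf_Times:
  "measure_pmf.prob (pair_pmf M N) (A \<times> B) = measure_pmf.prob M A * measure_pmf.prob N B"
proof -
  have "measure_pmf.prob (pair_pmf M N) (A \<times> B) =
        measure_pmf.prob (pair_pmf M N) ((A \<inter> set_pmf M) \<times> (B \<inter> set_pmf N))"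
    by (subst measure_Int_set_pmf[symmetric]) (simp add: Times_Int_Times)
  also have "\<dots> = measure_pmf.prob M (A \<inter> set_pmf M) * measure_pmf.prob N (B \<inter> set_pmf N)"
    by (intro measure_pmf_prob_product countable_Int2 countable_set_pmf)
  finally show ?thesis by (simp add: measure_Int_set_pmf)
qed

text \<open>Splitting off the first of the independent samples turns the event into a
  rectangle.\<close>

lemma prob_replicate_pmf_all:
  "measure_pmf.prob (replicate_pmf m D) {xs. \<forall>x\<in>set xs. Q x} = measure_pmf.prob D {x. Q x} ^ m"
proof (induction m)
  case 0
  then show ?case by simp
next
  case (Suc m)
  have "measure_pmf.prob (replicate_pmf (Suc m) D) {xs. \<forall>x\<in>set xs. Q x} =
        measure_pmf.prob (pair_pmf D (replicate_pmf m D)) ({x. Q x} \<times> {xs. \<forall>x\<in>set xs. Q x})"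
  proof -
    have "replicate_pmf (Suc m) D = map_pmf (\<lambda>(x, xs). x # xs) (pair_pmf D (replicate_pmf m D))"
      by (simp add: pair_pmf_def map_pmf_def bind_assoc_pmf bind_return_pmf)
    moreover have "(\<lambda>(x, xs). x # xs) -` {xs. \<forall>x\<in>set xs. Q x} = {x. Q x} \<times> {xs. \<forall>x\<in>set xs. Q x}"
      by auto
    ultimately show ?thesis by simp
  qed
  then show ?case
    using Suc by (simp only: prob_pair_pmf_Times power_Suc)
qed

lemma set_pmf_random_edge: "set_pmf (random_edge n p) \<subseteq> Pow {1..n}"
  by (auto simp: random_edge_def)

text \<open>Vertices inside \<open>S\<close> are unconstrained; each of the
  \<open>n - card S\<close> others must be left out.\<close>

lemma prob_random_edge_subset:
  assumes "0 \<le> p" "p \<le> 1" "S \<subseteq> {1..n}"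
  shows "measure_pmf.prob (random_edge n p) {e. e \<subseteq> S} = (1 - p) ^ (n - card S)"
proof -
  have "(\<lambda>f. {v \<in> {1..n}. f v}) -` {e. e \<subseteq> S} = Pi {1..n} (\<lambda>v. if v \<in> S then UNIV else {False})"
    by (auto simp: Pi_def split: if_splits)
  then have "measure_pmf.prob (random_edge n p) {e. e \<subseteq> S} =
      (\<Prod>v\<in>{1..n}. measure_pmf.prob (bernoulli_pmf p) (if v \<in> S then UNIV else {False}))"
    by (simp add: random_edge_def measure_Pi_pmf_Pi)
  also have "\<dots> = (\<Prod>v\<in>{1..n}. if v \<in> S then 1 else 1 - p)"
    using assms by (intro prod.cong) (auto simp: measure_pmf_single)
  also have "\<dots> = (\<Prod>v\<in>{1..n} - S. 1 - p)"
    by (intro prod.mono_neutral_cong_right) auto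
  also have "\<dots> = (1 - p) ^ (n - card S)"
    using assms by (simp add: card_Diff_subset finite_subset)
  finally show ?thesis .
qed

lemma pmf_random_edge:
  assumes "0 \<le> p" "p \<le> 1" "S \<subseteq> {1..n}"
  shows "pmf (random_edge n p) S = p ^ card S * (1 - p) ^ (n - card S)"
proof -
  have "(\<lambda>f. {v \<in> {1..n}. f v}) -` {S} = Pi {1..n} (\<lambda>v. {v \<in> S})"
    using assms(3) unfolding Pi_def vimage_def by (intro Collect_cong) blast
  then have "pmf (random_edge n p) S =
      (\<Prod>v\<in>{1..n}. measure_pmf.prob (bernoulli_pmf p) {v \<in> S})"
    by (simp add: random_edge_def measure_Pi_pmf_Pi flip: measure_pmf_single)
  also have "\<dots> = (\<Prod>v\<in>{1..n}. if v \<in> S then p else 1 - p)"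
    using assms by (intro prod.cong) (auto simp: measure_pmf_single)
  also have "\<dots> = (\<Prod>v\<in>S. p) * (\<Prod>v\<in>{1..n} - S. 1 - p)"
    using assms(3) by (subst prod.If_cases) (auto simp: Int_absorb1 Diff_eq)
  also have "\<dots> = p ^ card S * (1 - p) ^ (n - card S)"
    using assms by (simp add: card_Diff_subset finite_subset)
  finally show ?thesis .
qed

lemma sum_Pow_card:
  fixes g :: "nat \<Rightarrow> real"
  assumes "finite A"
  shows "(\<Sum>S\<in>Pow A. g (card S)) = (\<Sum>i\<le>card A. real (card A choose i) * g i)"
proof -
  have "(\<Sum>S\<in>Pow A. g (card S)) = (\<Sum>i\<le>card A. \<Sum>S\<in>{S \<in> Pow A. card S = i}. g (card S))"
    using assms by (intro sum.group[symmetric]) (auto intro: card_mono)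
  also have "\<dots> = (\<Sum>i\<le>card A. real (card A choose i) * g i)"
    using n_subsets[OF assms] by (intro sum.cong) (simp_all add: Pow_def)
  finally show ?thesis .
qed

text \<open>Linearity of expectation over all candidate sets \<open>e\<close>. Each probability
  depends only on \<open>card e\<close>, so the candidates are finally grouped by size.\<close>

lemma expected_min_size_eq:
  assumes "0 \<le> p" "p \<le> 1"
  shows "expected_min_size n m p =
    (\<Sum>i\<le>n. real (n choose i) *
       ((1 - (1 - p) ^ (n - i) * (1 - p ^ i)) ^ m - (1 - (1 - p) ^ (n - i)) ^ m))"
proof -
  define R where "R = replicate_pmf m (random_edge n p)"
  \<comment> \<open>The event that \<open>e\<close> is a minimal edge of the sampled list.\<close>
  define A where "A = (\<lambda>e. {xs. e \<in> set xs \<and> (\<forall>f\<in>set xs. \<not> f \<subset> e)} :: nat set list set)"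
  have R: "set xs \<subseteq> Pow {1..n}" if "xs \<in> set_pmf R" for xs
    using that set_pmf_random_edge unfolding R_def set_replicate_pmf by fastforce
  have "expected_min_size n m p =
        measure_pmf.expectation R (\<lambda>xs. real (card (minimization (mset xs))))"
    by (simp add: expected_min_size_def random_multi_hypergraph_def R_def)
  also have "\<dots> = measure_pmf.expectation R (\<lambda>xs. \<Sum>e\<in>Pow {1..n}. indicator (A e) xs)"
  proof (intro integral_cong_AE AE_pmfI)
    fix xs assume "xs \<in> set_pmf R"
    from R[OF this] have "minimization (mset xs) = Pow {1..n} \<inter> {e. xs \<in> A e}"
      by (auto simp: minimization_def A_def)
    then show "real (card (minimization (mset xs))) = (\<Sum>e\<in>Pow {1..n}. indicator (A e) xs)"
      by (simp add: indicator_def sum.If_cases)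
  qed simp_all
  also have "\<dots> = (\<Sum>e\<in>Pow {1..n}. measure_pmf.prob R (A e))"
    by (subst Bochner_Integration.integral_sum)
       (auto intro!: integrable_real_indicator simp: measure_pmf.emeasure_eq_measure)
  also have "\<dots> = (\<Sum>e\<in>Pow {1..n}. (1 - (1 - p) ^ (n - card e) * (1 - p ^ card e)) ^ m
                     - (1 - (1 - p) ^ (n - card e)) ^ m)"
  proof (intro sum.cong refl)
    fix e assume e: "e \<in> Pow {1..n}"
    let ?D = "random_edge n p"
    have sub: "measure_pmf.prob ?D {f. f \<subseteq> e} = (1 - p) ^ (n - card e)"
      using assms e by (intro prob_random_edge_subset) auto
    have "measure_pmf.prob ?D ({f. f \<subseteq> e} - {e}) =
          measure_pmf.prob ?D {f. f \<subseteq> e} - measure_pmf.prob ?D {e}"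
      by (intro measure_pmf.finite_measure_Diff) auto
    moreover have "{f. f \<subseteq> e} - {e} = {f. f \<subset> e}" by auto
    moreover have "measure_pmf.prob ?D {e} = p ^ card e * (1 - p) ^ (n - card e)"
      using assms e by (simp add: measure_pmf_single pmf_random_edge)
    ultimately have psub:
      "measure_pmf.prob ?D {f. f \<subset> e} = (1 - p) ^ (n - card e) * (1 - p ^ card e)"
      using sub by (simp add: algebra_simps)
    have compl: "measure_pmf.prob ?D {f. \<not> P f} = 1 - measure_pmf.prob ?D {f. P f}" for P
      using measure_pmf.prob_compl[of "{f. P f}" ?D] by (simp add: Compl_eq_Diff_UNIV[symmetric] Collect_neg_eq)
    \<comment> \<open>If no sample is a proper subset of \<open>e\<close>, then \<open>e\<close> is
      sampled iff some sample is a subset of \<open>e\<close>. Both events on the right constrain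
      every sample separately, so their probabilities are \<open>m\<close>-th powers.\<close>
    have "A e = {xs. \<forall>f\<in>set xs. \<not> f \<subset> e} - {xs. \<forall>f\<in>set xs. \<not> f \<subseteq> e}"
      by (auto simp: A_def)
    then have "measure_pmf.prob R (A e) =
        measure_pmf.prob R {xs. \<forall>f\<in>set xs. \<not> f \<subset> e} - measure_pmf.prob R {xs. \<forall>f\<in>set xs. \<not> f \<subseteq> e}"
      by (simp, intro measure_pmf.finite_measure_Diff) auto
    then show "measure_pmf.prob R (A e) =
        (1 - (1 - p) ^ (n - card e) * (1 - p ^ card e)) ^ m - (1 - (1 - p) ^ (n - card e)) ^ m"
      by (simp only: R_def prob_replicate_pmf_all compl sub psub)
  qed
  also have "\<dots> = (\<Sum>i\<le>n. real (n choose i) *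
       ((1 - (1 - p) ^ (n - i) * (1 - p ^ i)) ^ m - (1 - (1 - p) ^ (n - i)) ^ m))"
    using sum_Pow_card[of "{1..n}" "\<lambda>i. (1 - (1 - p) ^ (n - i) * (1 - p ^ i)) ^ m
                     - (1 - (1 - p) ^ (n - i)) ^ m"] by simp
  finally show ?thesis .
qed

lemma minimization_replicate_mset: "m \<ge> 1 \<Longrightarrow> minimization (replicate_mset m e) = {e}"
  by (auto simp: minimization_def)

text \<open>No randomness is left: all samples equal one fixed set, and its copies count
  once.\<close>

lemma card_minimization_degenerate:
  assumes "p = 0 \<or> p = 1"
  shows "is_maximum
    {card (minimization H) | m H. m \<ge> 1 \<and> H \<in> set_pmf (random_multi_hypergraph n m p)} 1"
proof -
  obtain e where e: "set_pmf (random_edge n p) \<subseteq> {e}"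
  proof (cases "p = 0")
    case True
    then have "bernoulli_pmf p = return_pmf False"
      by (intro pmf_eqI, rename_tac b, case_tac b) auto
    then have "set_pmf (random_edge n p) \<subseteq> {{}}"
      by (simp add: random_edge_def)
    then show ?thesis by (rule that)
  next
    case False
    then have "bernoulli_pmf p = return_pmf True"
      using assms by (intro pmf_eqI, rename_tac b, case_tac b) auto
    then have "set_pmf (random_edge n p) \<subseteq> {{1..n}}"
      by (auto simp: random_edge_def)
    then show ?thesis by (rule that)
  qed
  have "card (minimization H) = 1"
    if m: "m \<ge> 1" and H: "H \<in> set_pmf (random_multi_hypergraph n m p)" for m H
  proof -
    from H obtain xs where "H = mset xs" "set xs \<subseteq> {e}" "length xs = m"
      using e by (auto simp: random_multi_hypergraph_def set_replicate_pmf)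
    then have "H = replicate_mset m e"
      by (metis mset_replicate replicate_eqI singletonD subsetD)
    then show ?thesis using m by (simp add: minimization_replicate_mset)
  qed
  moreover obtain H where "H \<in> set_pmf (random_multi_hypergraph n 1 p)"
    using set_pmf_not_empty by fast
  ultimately show ?thesis
    unfolding is_maximum_def by (auto intro!: exI[of _ 1] exI[of _ H] simp: eq_commute[of "Suc 0"])
qed

section \<open>The mode of the binomial distribution\<close>

text \<open>The ratio of consecutive binomial masses in cross-multiplied form, from the two
  absorption identities for binomial coefficients.\<close>

lemma Bernstein_Suc:
  assumes "k < n"
  shows "real (Suc k) * (1 - x) * Bernstein n (Suc k) x = (real n - real k) * x * Bernstein n k x"
proof -
  have "Suc k * (n choose Suc k) = (n - k) * (n choose k)"
    using binomial_absorption[of k n] binomial_absorb_comp[of n k] by simp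
  then have "real (Suc k) * real (n choose Suc k) = (real n - real k) * real (n choose k)"
    using assms by (metis of_nat_mult of_nat_diff less_imp_le)
  moreover have "(1 - x) ^ (n - k) = (1 - x) * (1 - x) ^ (n - Suc k)"
    using assms by (metis Suc_diff_Suc power_Suc)
  ultimately show ?thesis
    by (simp add: Bernstein_def)
qed

text \<open>The binomial variance, obtained by writing the square through the factorial moment of
  \<open>k * (k - 1)\<close> and the mean.\<close>

lemma sum_variance_Bernstein:
  "(\<Sum>k\<le>n. (real k - real n * x)\<^sup>2 * Bernstein n k x) = real n * x * (1 - x)"
proof -
  have "(\<Sum>k\<le>n. (real k - real n * x)\<^sup>2 * Bernstein n k x) =
        (\<Sum>k\<le>n. real k * (real k - 1) * Bernstein n k x
           + (1 - 2 * real n * x) * (real k * Bernstein n k x) + (real n * x)\<^sup>2 * Bernstein n k x)"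
    by (intro sum.cong) (auto simp: algebra_simps power2_eq_square)
  also have "\<dots> = real n * (real n - 1) * x\<^sup>2 + (1 - 2 * real n * x) * (real n * x) + (real n * x)\<^sup>2"
    by (simp add: sum.distrib flip: sum_distrib_left)
  also have "\<dots> = real n * x * (1 - x)"
    by (simp add: algebra_simps power2_eq_square)
  finally show ?thesis .
qed

text \<open>For \<open>0 < x < 1\<close>, passing from \<open>k\<close> to \<open>k + 1\<close> does
  not decrease the binomial mass exactly when \<open>k + 1 \<le> (n + 1) * x\<close>, so the masses
  peak at this floor.\<close>

definition binomial_mode :: "nat \<Rightarrow> real \<Rightarrow> nat" where
  "binomial_mode n x = nat \<lfloor>(real n + 1) * x\<rfloor>"

lemma binomial_mode_bounds:
  assumes "0 \<le> x"
  shows "real (binomial_mode n x) \<le> (real n + 1) * x" "(real n + 1) * x < real (binomial_mode n x) + 1"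
proof -
  have "0 \<le> (real n + 1) * x" using assms by simp
  then show "real (binomial_mode n x) \<le> (real n + 1) * x"
      "(real n + 1) * x < real (binomial_mode n x) + 1"
    unfolding binomial_mode_def by linarith+
qed

lemma binomial_mode_le:
  assumes "0 \<le> x" "x < 1"
  shows "binomial_mode n x \<le> n"
proof -
  have "(real n + 1) * x < (real n + 1) * 1" using assms by (intro mult_strict_left_mono) auto
  with binomial_mode_bounds(1)[OF assms(1), of n] have "real (binomial_mode n x) < real n + 1"
    by (metis le_less_trans mult.right_neutral)
  then show ?thesis by linarith
qed

text \<open>By \<open>Bernstein_Suc\<close> the masses increase weakly up to the mode and decrease
  weakly after it.\<close>

lemma Bernstein_le_mode:
  assumes x: "0 < x" "x < 1"
  shows "Bernstein n k x \<le> Bernstein n (binomial_mode n x) x"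
proof -
  let ?j = "binomial_mode n x"
  note mode = binomial_mode_bounds[of x n] binomial_mode_le[of x n]
  have up: "Bernstein n k x \<le> Bernstein n (Suc k) x" if "k < ?j" for k
  proof -
    have kn: "k < n" using that mode x by auto
    have "real (Suc k) \<le> (real n + 1) * x" using that mode x by linarith
    then have "real (Suc k) * (1 - x) \<le> (real n - real k) * x"
      by (simp add: algebra_simps)
    then have "real (Suc k) * (1 - x) * Bernstein n k x \<le> real (Suc k) * (1 - x) * Bernstein n (Suc k) x"
      unfolding Bernstein_Suc[OF kn] using x by (intro mult_right_mono Bernstein_nonneg) auto
    then show ?thesis using x by (simp add: mult_le_cancel_left_pos)
  qed
  have down: "Bernstein n (Suc k) x \<le> Bernstein n k x" if "k \<ge> ?j" for k
  proof (cases "k < n")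
    case True
    have "(real n + 1) * x \<le> real (Suc k)" using that mode x by simp
    then have "(real n - real k) * x \<le> real (Suc k) * (1 - x)"
      by (simp add: algebra_simps)
    then have "real (Suc k) * (1 - x) * Bernstein n (Suc k) x \<le> real (Suc k) * (1 - x) * Bernstein n k x"
      unfolding Bernstein_Suc[OF True] using x by (intro mult_right_mono Bernstein_nonneg) auto
    then show ?thesis using x by (simp add: mult_le_cancel_left_pos)
  next
    case False
    then have "Bernstein n (Suc k) x = 0" by (simp add: Bernstein_def)
    then show ?thesis using x Bernstein_nonneg[of x n k] by simp
  qed
  show ?thesis
  proof (cases "k \<le> ?j")
    case True
    then show ?thesis
      by (induction rule: inc_induct) (auto intro: order_trans up)
  next
    case False
    then have "?j \<le> k" by simp
    then show ?thesis
      by (induction rule: dec_induct) (auto intro: order_trans down)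
  qed
qed

text \<open>With \<open>N = (n + 1) * x * (1 - x)\<close>, the step to distance \<open>j + 1\<close>
  from the mode keeps at least the fraction \<open>1 - (j + 1) / N\<close> of the mass. The losses
  add up to at most \<open>j^2 / N\<close> after \<open>j\<close> steps.\<close>

lemma Bernstein_beyond_mode_ge:
  assumes x: "0 < x" "x < 1" and "binomial_mode n x + j \<le> n"
  shows "Bernstein n (binomial_mode n x + j) x \<ge>
         Bernstein n (binomial_mode n x) x * (1 - (real j)\<^sup>2 / ((real n + 1) * x * (1 - x)))"
  using assms(3)
proof (induction j)
  case 0
  then show ?case by simp
next
  case (Suc j)
  define N where "N = (real n + 1) * x * (1 - x)"
  define B where "B = (\<lambda>k. Bernstein n k x)"
  define i where "i = binomial_mode n x"
  have N: "N > 0" using x by (simp add: N_def)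
  have Bi: "B i \<ge> 0" "B (i + Suc j) \<ge> 0" using x by (auto simp: B_def Bernstein_nonneg)
  show ?case
  \<comment> \<open>The induction hypothesis may only be multiplied by a nonnegative factor
    \<open>1 - real (Suc j) / N\<close>. In the other case the claimed lower bound is itself
    nonpositive.\<close>
  proof (cases "real (Suc j) \<le> N")
    case True
    have IH: "B (i + j) \<ge> B i * (1 - (real j)\<^sup>2 / N)"
      using Suc by (simp add: N_def B_def i_def)
    have ij: "i + j < n" using Suc.prems by (simp add: i_def)
    note mode = binomial_mode_bounds[of x n, folded i_def]
    \<comment> \<open>The denominator of the ratio of consecutive masses; it is at least
      \<open>N\<close> because \<open>i + 1\<close> exceeds \<open>(n + 1) * x\<close>.\<close>
    define d where "d = real (Suc (i + j)) * (1 - x)"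
    have d: "d > 0" using x by (simp add: d_def)
    have Nd: "N \<le> d"
      unfolding N_def d_def using x mode by (intro mult_right_mono) auto
    have "(real n - real (i + j)) * x = d - (real (Suc (i + j)) - (real n + 1) * x)"
      by (simp add: d_def algebra_simps)
    moreover have "real (Suc (i + j)) - (real n + 1) * x \<le> real (Suc j)"
      using mode x by simp
    moreover have "real (Suc j) * N \<le> real (Suc j) * d"
      using Nd by (intro mult_left_mono) auto
    then have "real (Suc j) \<le> d * (real (Suc j) / N)" using N by (simp add: field_simps)
    ultimately have ratio: "d * (1 - real (Suc j) / N) \<le> (real n - real (i + j)) * x"
      by (simp add: right_diff_distrib)
    have "d * B (i + Suc j) = (real n - real (i + j)) * x * B (i + j)"
      using Bernstein_Suc[OF ij] by (simp add: d_def B_def)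
    also have "\<dots> \<ge> d * (1 - real (Suc j) / N) * B (i + j)"
      using ratio x by (intro mult_right_mono) (auto simp: B_def Bernstein_nonneg)
    finally have "B (i + Suc j) \<ge> (1 - real (Suc j) / N) * B (i + j)"
      using d by (simp add: mult.assoc)
    moreover have "(1 - real (Suc j) / N) * B (i + j) \<ge> (1 - real (Suc j) / N) * (B i * (1 - (real j)\<^sup>2 / N))"
      using IH True N by (intro mult_left_mono) auto
    moreover have "(1 - real (Suc j) / N) * (1 - (real j)\<^sup>2 / N) \<ge> 1 - (real (Suc j))\<^sup>2 / N"
    proof -
      have "(1 - real (Suc j) / N) * (1 - (real j)\<^sup>2 / N) =
            1 - (real (Suc j))\<^sup>2 / N + real j / N + real (Suc j) / N * ((real j)\<^sup>2 / N)"
        by (simp add: algebra_simps power2_eq_square add_divide_distrib)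
      then show ?thesis using N by simp
    qed
    then have "B i * (1 - (real (Suc j))\<^sup>2 / N) \<le> B i * ((1 - real (Suc j) / N) * (1 - (real j)\<^sup>2 / N))"
      using Bi by (intro mult_left_mono) auto
    ultimately have "B (i + Suc j) \<ge> B i * (1 - (real (Suc j))\<^sup>2 / N)"
      by (simp add: mult_ac)
    then show ?thesis by (simp add: B_def i_def N_def)
  next
    case False
    have "real (Suc j) * 1 \<le> real (Suc j) * real (Suc j)" by (intro mult_left_mono) auto
    moreover have "N \<le> real (Suc j) * 1" using False by simp
    ultimately have "N \<le> (real (Suc j))\<^sup>2" unfolding power2_eq_square by (rule order_trans[rotated])
    then have "1 - (real (Suc j))\<^sup>2 / N \<le> 0" using N by simp
    then have "B i * (1 - (real (Suc j))\<^sup>2 / N) \<le> 0" using Bi by (intro mult_nonneg_nonpos)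
    then show ?thesis using Bi(2) by (simp add: B_def i_def N_def)
  qed
qed


text \<open>At least about \<open>\<surd>n\<close> terms to the right of the mode have half the modal mass, and all
  the masses sum to 1.\<close>

lemma Bernstein_mode_upper:
  assumes x: "0 < x" "x < 1"
  shows "Bernstein n (binomial_mode n x) x * sqrt ((real n + 1) * x * (1 - x) / 2) \<le> 2"
proof -
  define N where "N = (real n + 1) * x * (1 - x)"
  define i where "i = binomial_mode n x"
  \<comment> \<open>The largest distance for which the loss \<open>K^2 / N\<close> is at most one
    half.\<close>
  define K where "K = nat \<lfloor>sqrt (N / 2)\<rfloor>"
  define B where "B = Bernstein n i x"
  have N: "N > 0" using x by (simp add: N_def)
  have B: "B \<ge> 0" using x by (simp add: B_def Bernstein_nonneg)
  have "0 \<le> sqrt (N / 2)" using N by simp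
  then have K: "real K \<le> sqrt (N / 2)" "sqrt (N / 2) \<le> real (Suc K)"
    unfolding K_def by linarith+
  have "(real K)\<^sup>2 \<le> (sqrt (N / 2))\<^sup>2" using K by (intro power_mono) auto
  then have K2: "(real K)\<^sup>2 \<le> N / 2" using N by simp
  \<comment> \<open>The window to the right of the mode stays within the range:
    \<open>K \<le> K^2 < N \<le> (n + 1) * (1 - x)\<close>, while
    \<open>i \<le> (n + 1) * x\<close>.\<close>
  have iK: "i + K \<le> n"
  proof -
    have "K \<le> K * K" by (cases K) auto
    then have "real K \<le> (real K)\<^sup>2" unfolding power2_eq_square by (metis of_nat_le_iff of_nat_mult)
    also have "\<dots> \<le> N / 2" by (rule K2)
    also have "N / 2 < N" using N by simp
    also have "N \<le> (real n + 1) * 1 * (1 - x)"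
      unfolding N_def using x by (intro mult_right_mono mult_left_mono) auto
    finally have "real K < (real n + 1) - (real n + 1) * x" by (simp add: algebra_simps)
    moreover have "real i \<le> (real n + 1) * x"
      using binomial_mode_bounds(1)[of x n] x by (simp add: i_def)
    ultimately show ?thesis by linarith
  qed
  have half: "B / 2 \<le> Bernstein n (i + j) x" if "j \<le> K" for j
  proof -
    have "(real j)\<^sup>2 \<le> (real K)\<^sup>2" using that by (intro power_mono) auto
    with K2 have "(real j)\<^sup>2 \<le> N / 2" by (rule order_trans[rotated])
    then have "(real j)\<^sup>2 / N \<le> 1 / 2" using N by (simp add: field_simps)
    then have "B * (1 / 2) \<le> B * (1 - (real j)\<^sup>2 / N)" using B by (intro mult_left_mono) auto
    also have "\<dots> \<le> Bernstein n (i + j) x"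
      unfolding B_def i_def N_def using that iK x by (intro Bernstein_beyond_mode_ge) (auto simp: i_def)
    finally show ?thesis by simp
  qed
  have "real (Suc K) * (B / 2) = (\<Sum>j\<le>K. B / 2)" by simp
  also have "\<dots> \<le> (\<Sum>j\<le>K. Bernstein n (i + j) x)" by (intro sum_mono half) auto
  also have "\<dots> = (\<Sum>k\<in>(+) i ` {..K}. Bernstein n k x)"
    by (subst sum.reindex) auto
  also have "\<dots> \<le> (\<Sum>k\<le>n. Bernstein n k x)"
    using iK x by (intro sum_mono2 Bernstein_nonneg) auto
  finally have "B * real (Suc K) \<le> 2" by (simp add: mult.commute)
  moreover have "B * sqrt (N / 2) \<le> B * real (Suc K)" using K B by (intro mult_left_mono) auto
  ultimately show ?thesis by (simp add: B_def N_def i_def)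
qed

lemma card_nat_near_le:
  fixes c s :: real
  assumes "s \<ge> 0"
  shows "finite {k::nat. \<bar>real k - c\<bar> < s}" "real (card {k::nat. \<bar>real k - c\<bar> < s}) \<le> 2 * s + 1"
proof -
  let ?A = "{k::nat. \<bar>real k - c\<bar> < s}" and ?I = "{\<lceil>c - s\<rceil>..\<lfloor>c + s\<rfloor>}"
  have sub: "int ` ?A \<subseteq> ?I" by (auto simp: ceiling_le_iff le_floor_iff)
  then show "finite ?A" using finite_subset[OF sub] by (auto dest: finite_imageD)
  have "card ?A = card (int ` ?A)" by (simp add: card_image)
  also have "\<dots> \<le> card ?I" using sub by (intro card_mono) auto
  finally have "card ?A \<le> nat (\<lfloor>c + s\<rfloor> - \<lceil>c - s\<rceil> + 1)" by simp
  then show "real (card ?A) \<le> 2 * s + 1" using assms by linarith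
qed

text \<open>By Chebyshev at radius \<open>\<surd>n\<close>, at least \<open>3/4\<close> of the mass is spread over at most
  \<open>3\<surd>n\<close> terms.\<close>

lemma Bernstein_mode_lower:
  assumes x: "0 < x" "x < 1" and n: "n \<ge> 1"
  shows "Bernstein n (binomial_mode n x) x \<ge> 1 / (4 * sqrt (real n))"
proof -
  define B where "B = Bernstein n (binomial_mode n x) x"
  define F where "F = {k::nat. \<bar>real k - real n * x\<bar> < sqrt (real n)}"
  have B: "B \<ge> 0" using x by (simp add: B_def Bernstein_nonneg)
  have F: "finite F" "real (card F) \<le> 2 * sqrt (real n) + 1"
    unfolding F_def by (intro card_nat_near_le; simp)+
  \<comment> \<open>Chebyshev term by term: within \<open>F\<close> the mode dominates, and outside
    \<open>F\<close> the weight \<open>(k - n * x)^2 / n\<close> is at least 1.\<close>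
  have pointwise: "Bernstein n k x \<le> (real k - real n * x)\<^sup>2 * Bernstein n k x / real n
                      + (if k \<in> F then B else 0)" for k
  proof (cases "k \<in> F")
    case True
    have "0 \<le> (real k - real n * x)\<^sup>2 * Bernstein n k x / real n"
      using x by (simp add: Bernstein_nonneg)
    then show ?thesis using True Bernstein_le_mode[OF x, of n k] by (simp add: B_def)
  next
    case False
    then have "sqrt (real n) \<le> \<bar>real k - real n * x\<bar>" by (simp add: F_def)
    then have "(sqrt (real n))\<^sup>2 \<le> \<bar>real k - real n * x\<bar>\<^sup>2" by (intro power_mono) auto
    then have "real n * Bernstein n k x \<le> (real k - real n * x)\<^sup>2 * Bernstein n k x"
      using x by (intro mult_right_mono Bernstein_nonneg) auto
    then show ?thesis using False n by (simp add: field_simps)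
  qed
  have "1 = (\<Sum>k\<le>n. Bernstein n k x)" by simp
  also have "\<dots> \<le> (\<Sum>k\<le>n. (real k - real n * x)\<^sup>2 * Bernstein n k x / real n + (if k \<in> F then B else 0))"
    by (intro sum_mono pointwise)
  also have "\<dots> = real n * x * (1 - x) / real n + (\<Sum>k\<le>n. if k \<in> F then B else 0)"
    by (simp only: sum.distrib sum_variance_Bernstein flip: sum_divide_distrib)
  also have "(\<Sum>k\<le>n. if k \<in> F then B else 0) \<le> (\<Sum>k\<in>F. B)"
    using F B by (subst sum.inter_restrict[symmetric]) (auto intro!: sum_mono2 simp: mult_right_mono card_mono)
  also have "(\<Sum>k\<in>F. B) \<le> (3 * sqrt (real n)) * B"
  proof -
    have "1 \<le> sqrt (real n)" using n by simp
    with F have "real (card F) \<le> 3 * sqrt (real n)" by linarith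
    then show ?thesis using B by (simp add: mult_right_mono)
  qed
  also have "real n * x * (1 - x) / real n \<le> 1 / 4"
  proof -
    have "0 \<le> (x - 1 / 2)\<^sup>2" by simp
    then have "x * (1 - x) \<le> 1 / 4" by (simp add: power2_eq_square algebra_simps)
    then show ?thesis using n by simp
  qed
  finally have "1 \<le> 1 / 4 + 3 * sqrt (real n) * B" by simp
  then have "1 \<le> 4 * (sqrt (real n) * B)" by simp
  then show ?thesis using n by (simp add: B_def field_simps)
qed

section \<open>Asymptotics\<close>

text \<open>Each of the \<open>m\<close> products in the factorisation of
  \<open>x ^ m - y ^ m\<close> is at most \<open>x ^ (m - 1)\<close>; the companion bound uses
  \<open>y ^ (m - 1)\<close> from below.\<close>

lemma power_diff_le:
  fixes x y :: real
  assumes "0 \<le> y" "y \<le> x"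
  shows "x ^ m - y ^ m \<le> real m * (x - y) * x ^ (m - 1)"
proof -
  have "x ^ m - y ^ m = (x - y) * (\<Sum>i<m. y ^ (m - Suc i) * x ^ i)"
    by (rule power_diff_sumr2)
  also have "\<dots> \<le> (x - y) * (\<Sum>i<m. x ^ (m - 1))"
  proof (intro mult_left_mono sum_mono)
    fix i assume "i \<in> {..<m}"
    then have "m - 1 = (m - Suc i) + i" by auto
    then have "x ^ (m - 1) = x ^ (m - Suc i) * x ^ i" by (simp only: power_add)
    then show "y ^ (m - Suc i) * x ^ i \<le> x ^ (m - 1)"
      using assms by (auto intro!: mult_right_mono power_mono)
  qed (use assms in auto)
  finally show ?thesis by (simp add: mult_ac)
qed

lemma power_diff_ge:
  fixes x y :: real
  assumes "0 \<le> y" "y \<le> x"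
  shows "real m * (x - y) * y ^ (m - 1) \<le> x ^ m - y ^ m"
proof -
  have "(x - y) * (\<Sum>i<m. y ^ (m - 1)) \<le> (x - y) * (\<Sum>i<m. y ^ (m - Suc i) * x ^ i)"
  proof (intro mult_left_mono sum_mono)
    fix i assume "i \<in> {..<m}"
    then have "m - 1 = (m - Suc i) + i" by auto
    then have "y ^ (m - 1) = y ^ (m - Suc i) * y ^ i" by (simp only: power_add)
    then show "y ^ (m - 1) \<le> y ^ (m - Suc i) * x ^ i"
      using assms by (auto intro!: mult_left_mono power_mono)
  qed (use assms in auto)
  also have "\<dots> = x ^ m - y ^ m"
    by (rule power_diff_sumr2[symmetric])
  finally show ?thesis by (simp add: mult_ac)
qed

text \<open>Terms below 1 and reciprocals of terms above 1 are both dominated by geometric series,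
  so the bound is uniform in \<open>t\<close> and \<open>n\<close>.\<close>

lemma sum_min_geometric_le:
  fixes q t :: real
  assumes q: "0 < q" "q < 1" and "t > 0"
  shows "(\<Sum>k<n. min (t * q ^ k) (1 / (t * q ^ k))) \<le> 2 / (1 - q)"
proof -
  \<comment> \<open>a potential satisfying \<open>min t (1 / t) + \<beta> (t * q) \<le> \<beta> t\<close>\<close>
  define \<beta> where "\<beta> = (\<lambda>t. if t \<le> 1 then t / (1 - q) else (2 - q / t) / (1 - q))"
  have "(\<Sum>k<n. min (t * q ^ k) (1 / (t * q ^ k))) \<le> \<beta> t"
    \<comment> \<open>Dropping the first summand leaves the same sum started at
      \<open>t * q\<close>, hence induction with arbitrary \<open>t\<close>.\<close>
    using \<open>t > 0\<close>
  proof (induction n arbitrary: t)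
    case 0
    have "q / t \<le> 2" if "t > 1" using that q by (simp add: field_simps)
    then show ?case using 0 q by (auto simp: \<beta>_def)
  next
    case (Suc n)
    have "(\<Sum>k<Suc n. min (t * q ^ k) (1 / (t * q ^ k))) =
          min t (1 / t) + (\<Sum>k<n. min ((t * q) * q ^ k) (1 / ((t * q) * q ^ k)))"
      by (simp add: sum.lessThan_Suc_shift mult_ac del: sum.lessThan_Suc)
    also have "\<dots> \<le> min t (1 / t) + \<beta> (t * q)"
      using Suc q by (intro add_left_mono) auto
    also have "\<dots> \<le> \<beta> t"
    proof -
      \<comment> \<open>The cases follow the branches of \<open>\<beta>\<close> at \<open>t\<close>
        and \<open>t * q\<close>. Only when the threshold 1 lies between them is there slack; it
        comes from \<open>1 / t \<le> 1\<close> and \<open>t * q \<le> 1\<close>.\<close>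
      consider "t \<le> 1" | "t > 1" "t * q \<le> 1" | "t * q > 1" by linarith
      then show ?thesis
      proof cases
        case 1
        then have "t * q \<le> 1" using q Suc.prems mult_mono[of t 1 q 1] by auto
        then have "\<beta> (t * q) = t / (1 - q) - t" using q by (simp add: \<beta>_def field_simps)
        then show ?thesis using 1 by (simp add: \<beta>_def)
      next
        case 2
        have "1 / t \<le> 1" using 2 by simp
        moreover have "1 / t + t * q / (1 - q) = ((1 - q) * (1 / t) + t * q) / (1 - q)"
          using q by (simp add: add_divide_distrib)
        moreover have "(1 - q) * (1 / t) + t * q \<le> 2 - q / t"
        proof -
          have "(1 - q) * (1 / t) + t * q = 1 / t - q / t + t * q" by (simp add: diff_divide_distrib)
          then show ?thesis using \<open>1 / t \<le> 1\<close> 2(2) by linarith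
        qed
        then have "((1 - q) * (1 / t) + t * q) / (1 - q) \<le> (2 - q / t) / (1 - q)"
          using q by (intro divide_right_mono) auto
        ultimately show ?thesis using 2 by (simp add: \<beta>_def min_def split: if_splits)
      next
        case 3
        moreover have "t * q \<le> t * 1" using q Suc.prems by (intro mult_left_mono) auto
        ultimately have t: "t > 1" by simp
        have "(2 - q / t) / (1 - q) = 1 / t + (2 - q / (t * q)) / (1 - q)"
          using q t by (simp add: field_simps)
        then show ?thesis using 3 t by (simp add: \<beta>_def min_def)
      qed
    qed
    finally show ?case .
  qed
  also have "\<beta> t \<le> 2 / (1 - q)"
    using q \<open>t > 0\<close> by (auto simp: \<beta>_def intro!: divide_right_mono)
  finally show ?thesis .
qed

text \<open>For small \<open>x\<close> the exponential is at most 1; for large \<open>x\<close>,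
  \<open>exp y \<ge> y^2 / 2\<close> at \<open>y = q * x\<close> gives the decay
  \<open>1 / x\<close>.\<close>

lemma x_exp_minus_le_min:
  fixes q x :: real
  assumes "0 < q" "q < 1" "0 < x"
  shows "x * exp (- q * x) \<le> 2 / q\<^sup>2 * min x (1 / x)"
proof -
  have "1 \<le> 2 / q\<^sup>2"
    using assms power_mono[of q 1 2] by (simp add: field_simps)
  moreover have "exp (- q * x) \<le> 1" using assms by simp
  ultimately have "exp (- q * x) \<le> 2 / q\<^sup>2" by (rule order_trans[rotated])
  then have "x * exp (- q * x) \<le> 2 / q\<^sup>2 * x"
    using assms by (subst mult.commute) (intro mult_right_mono, auto)
  moreover have "x * exp (- q * x) \<le> 2 / q\<^sup>2 * (1 / x)"
  proof -
    have "(q * x)\<^sup>2 / 2 \<le> exp (q * x)"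
      using exp_lower_Taylor_quadratic[of "q * x"] assms by (smt (verit) mult_pos_pos)
    then show ?thesis
      using assms by (simp add: exp_minus field_simps power2_eq_square)
  qed
  ultimately show ?thesis by (cases "x \<le> 1 / x") (simp_all only: min_def if_True if_False)
qed

text \<open>Intended for \<open>a = q ^ (n - i)\<close>, the probability that a sample lies inside a
  given \<open>i\<close>-set, and \<open>b = p ^ i\<close>, the conditional probability that it then
  equals this set. The difference of powers is linearised, and \<open>1 - b \<ge> q\<close> yields
  exponential decay in \<open>m * a\<close>.\<close>

lemma minimal_edge_term_upper:
  fixes a b q :: real
  assumes q: "0 < q" "q < 1" and a: "0 < a" "a \<le> 1" and b: "0 \<le> b" "b \<le> 1 - q" and m: "m \<ge> 1"
  shows "(1 - a * (1 - b)) ^ m - (1 - a) ^ m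
           \<le> b * (exp 1 * (2 / q\<^sup>2) * min (real m * a) (1 / (real m * a)))"
proof -
  have ab: "0 \<le> a * b" "a * b \<le> a" using a b q by (auto simp: mult_le_cancel_left1)
  define x where "x = 1 - a * (1 - b)"
  have x: "0 \<le> x" "1 - a \<le> x" "x - (1 - a) = a * b"
    using a ab by (auto simp: x_def algebra_simps)
  have "a * q \<le> a * (1 - b)" using a b by (intro mult_left_mono) auto
  then have "x \<le> 1 + - (a * q)" by (simp add: x_def)
  also have "\<dots> \<le> exp (- (a * q))" by (rule exp_ge_add_one_self)
  finally have "x ^ (m - 1) \<le> exp (- (a * q)) ^ (m - 1)" using x by (intro power_mono) auto
  \<comment> \<open>Having exponent \<open>m - 1\<close> instead of \<open>m\<close> costs the
    factor \<open>exp (a * q)\<close>, at most \<open>exp 1\<close>.\<close>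
  also have "\<dots> = exp (a * q) * exp (- q * (real m * a))"
    using m by (simp add: of_nat_diff algebra_simps flip: exp_of_nat_mult exp_add)
  also have "\<dots> \<le> exp 1 * exp (- q * (real m * a))"
    using a q mult_mono[of a 1 q 1] by (intro mult_right_mono) auto
  finally have x_pow: "x ^ (m - 1) \<le> exp 1 * exp (- q * (real m * a))" .
  have "x ^ m - (1 - a) ^ m \<le> real m * (a * b) * x ^ (m - 1)"
    using power_diff_le[of "1 - a" x m] x a by simp
  also have "\<dots> \<le> real m * (a * b) * (exp 1 * exp (- q * (real m * a)))"
    using x_pow ab by (intro mult_left_mono) auto
  also have "\<dots> = b * exp 1 * ((real m * a) * exp (- q * (real m * a)))" by simp
  also have "\<dots> \<le> b * exp 1 * (2 / q\<^sup>2 * min (real m * a) (1 / (real m * a)))"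
    using q a b m by (intro mult_left_mono x_exp_minus_le_min) auto
  finally show ?thesis by (simp add: x_def mult.assoc)
qed

text \<open>Linearisation at the smaller base \<open>1 - a\<close>, which is bounded below by an
  exponential as long as \<open>a\<close> stays away from 1.\<close>

lemma minimal_edge_term_lower:
  fixes a b q :: real
  assumes q: "0 < q" "q < 1" and a: "0 < a" "a \<le> q" and b: "0 \<le> b" "b \<le> 1"
  shows "b * (real m * a) * exp (- (real m * a / (1 - q))) \<le> (1 - a * (1 - b)) ^ m - (1 - a) ^ m"
proof -
  have "exp (- (a / (1 - q))) \<le> 1 - a"
  proof -
    \<comment> \<open>This is where \<open>a \<le> q\<close> enters; the factor
      \<open>1 / (1 - q)\<close> in the exponent is chosen to make the identity work.\<close>
    have "0 \<le> a * (q - a) / (1 - q)" using a q by auto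
    also have "\<dots> = (1 - a) * (1 + a / (1 - q)) - 1" using q by (simp add: field_simps)
    finally have "1 \<le> (1 - a) * (1 + a / (1 - q))" by simp
    also have "\<dots> \<le> (1 - a) * exp (a / (1 - q))"
      using a q exp_ge_add_one_self by (intro mult_left_mono) auto
    finally show ?thesis by (simp add: exp_minus field_simps)
  qed
  then have "exp (- (a / (1 - q))) ^ m \<le> (1 - a) ^ m" by (intro power_mono) auto
  also have "\<dots> \<le> (1 - a) ^ (m - 1)" using a q by (intro power_decreasing) auto
  finally have pow: "exp (- (real m * a / (1 - q))) \<le> (1 - a) ^ (m - 1)"
    by (simp flip: exp_of_nat_mult)
  have "b * (real m * a) * exp (- (real m * a / (1 - q))) \<le> b * (real m * a) * (1 - a) ^ (m - 1)"
    using pow a b by (intro mult_left_mono) auto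
  also have "\<dots> = real m * ((1 - a * (1 - b)) - (1 - a)) * (1 - a) ^ (m - 1)"
    by (simp add: algebra_simps)
  also have "\<dots> \<le> (1 - a * (1 - b)) ^ m - (1 - a) ^ m"
    using a b q by (intro power_diff_ge) (auto simp: algebra_simps)
  finally show ?thesis .
qed

section \<open>The largest weight and its order of growth\<close>

text \<open>The maximum over \<open>i \<le> n\<close> of \<open>(n choose i) * p ^ i\<close>.\<close>

definition peak :: "nat \<Rightarrow> real \<Rightarrow> real" where
  "peak n p = (1 + p) ^ n * Bernstein n (binomial_mode n (p / (1 + p))) (p / (1 + p))"

text \<open>For \<open>r = p / (1 + p)\<close> one has \<open>1 - r = 1 / (1 + p)\<close>, so
  \<open>r ^ i * (1 - r) ^ (n - i)\<close> equals \<open>p ^ i / (1 + p) ^ n\<close>.\<close>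

lemma binomial_times_power_eq_Bernstein:
  fixes p :: real
  assumes "0 < p" "i \<le> n"
  shows "real (n choose i) * p ^ i = (1 + p) ^ n * Bernstein n i (p / (1 + p))"
proof -
  have "(1 + p) ^ n = (1 + p) ^ i * (1 + p) ^ (n - i)"
    using assms by (simp flip: power_add)
  moreover have "1 - p / (1 + p) = 1 / (1 + p)" using assms by (simp add: field_simps)
  ultimately show ?thesis using assms
    by (simp add: Bernstein_def power_divide)
qed

lemma binomial_times_power_le_peak:
  fixes p :: real
  assumes "0 < p" "i \<le> n"
  shows "real (n choose i) * p ^ i \<le> peak n p"
  unfolding binomial_times_power_eq_Bernstein[OF assms] peak_def
  using assms by (intro mult_left_mono Bernstein_le_mode) auto

text \<open>The index 0 has weight exactly 1. This lets additive constants be absorbed into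
  \<open>peak\<close>.\<close>

lemma peak_ge_1: "0 < p \<Longrightarrow> 1 \<le> peak n p"
  using binomial_times_power_le_peak[of p 0 n] by simp

lemma peak_bigtheta:
  assumes "0 < p"
  shows "(\<lambda>n. peak n p) \<in> \<Theta>(\<lambda>n. (1 + p) ^ n / sqrt (real n))"
proof -
  define r where "r = p / (1 + p)"
  have r: "0 < r" "r < 1" using assms by (auto simp: r_def)
  \<comment> \<open>Chosen so that \<open>s * sqrt n\<close> is at most the square root in
    \<open>Bernstein_mode_upper\<close>, with \<open>n + 1\<close> weakened to
    \<open>n\<close>.\<close>
  define s where "s = sqrt (r * (1 - r) / 2)"
  have s: "s > 0" using r by (simp add: s_def)
  have upper: "peak n p \<le> 2 / s * ((1 + p) ^ n / sqrt (real n))" if "n \<ge> 1" for n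
  proof -
    let ?B = "Bernstein n (binomial_mode n r) r"
    have "s * sqrt (real n) = sqrt (r * (1 - r) / 2 * real n)"
      by (simp only: s_def real_sqrt_mult)
    also have "\<dots> \<le> sqrt (r * (1 - r) / 2 * (real n + 1))"
      using r by (intro real_sqrt_le_mono mult_left_mono) auto
    also have "r * (1 - r) / 2 * (real n + 1) = (real n + 1) * r * (1 - r) / 2" by simp
    finally have "?B * (s * sqrt (real n)) \<le> ?B * sqrt ((real n + 1) * r * (1 - r) / 2)"
      using r by (intro mult_left_mono Bernstein_nonneg) auto
    also have "\<dots> \<le> 2" by (rule Bernstein_mode_upper[OF r])
    finally have "?B \<le> 2 / s * (1 / sqrt (real n))" using s that by (simp add: field_simps)
    then have "(1 + p) ^ n * ?B \<le> (1 + p) ^ n * (2 / s * (1 / sqrt (real n)))"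
      using assms by (intro mult_left_mono) auto
    then show ?thesis by (simp add: peak_def r_def mult_ac)
  qed
  have lower: "(1 + p) ^ n / sqrt (real n) \<le> 4 * peak n p" if "n \<ge> 1" for n
  proof -
    have "(1 + p) ^ n * (1 / (4 * sqrt (real n))) \<le> peak n p"
      unfolding peak_def r_def[symmetric]
      using assms by (intro mult_left_mono Bernstein_mode_lower[OF r that]) auto
    then show ?thesis by simp
  qed
  have pk: "peak n p \<ge> 0" for n using peak_ge_1[OF assms, of n] by simp
  show ?thesis
  proof
    show "(\<lambda>n. peak n p) \<in> O(\<lambda>n. (1 + p) ^ n / sqrt (real n))"
      using upper pk assms
      by (intro bigoI[of _ "2 / s"] eventually_mono[OF eventually_ge_at_top[of 1]]) auto
    show "(\<lambda>n. peak n p) \<in> \<Omega>(\<lambda>n. (1 + p) ^ n / sqrt (real n))"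
      unfolding bigomega_iff_bigo using lower pk assms
      by (intro bigoI[of _ 4] eventually_mono[OF eventually_ge_at_top[of 1]]) auto
  qed
qed

section \<open>Two-sided bounds for the expectation\<close>

lemma expected_min_size_upper:
  assumes p: "0 < p" "p < 1" and m: "m \<ge> 1"
  shows "expected_min_size n m p \<le> (1 + 4 * exp 1 / (p * (1 - p)\<^sup>2)) * peak n p"
proof -
  define q where "q = 1 - p"
  have q: "0 < q" "q < 1" using p by (auto simp: q_def)
  define C where "C = exp 1 * (2 / q\<^sup>2)"
  have C: "C > 0" using q by (simp add: C_def)
  define \<phi> where "\<phi> = (\<lambda>k. min (real m * q ^ k) (1 / (real m * q ^ k)))"
  define T where "T = (\<lambda>i. real (n choose i) * ((1 - q ^ (n - i) * (1 - p ^ i)) ^ m - (1 - q ^ (n - i)) ^ m))"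
  have \<phi>: "\<phi> k \<ge> 0" for k using q by (simp add: \<phi>_def)
  \<comment> \<open>The empty set is treated apart: \<open>p ^ 0 = 1\<close> violates the condition
    \<open>b \<le> 1 - q\<close> of \<open>minimal_edge_term_upper\<close>.\<close>
  have T0: "T 0 \<le> 1" using q by (simp add: T_def power_le_one)
  have T: "T (Suc i) \<le> peak n p * (C * \<phi> (n - Suc i))" if "i < n" for i
  proof -
    have "p ^ Suc i \<le> p" using p power_decreasing[of 1 "Suc i" p] by simp
    then have "(1 - q ^ (n - Suc i) * (1 - p ^ Suc i)) ^ m - (1 - q ^ (n - Suc i)) ^ m
               \<le> p ^ Suc i * (C * \<phi> (n - Suc i))"
      unfolding C_def \<phi>_def using q p m
      by (intro minimal_edge_term_upper) (auto simp: q_def power_le_one)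
    then have "T (Suc i) \<le> real (n choose Suc i) * (p ^ Suc i * (C * \<phi> (n - Suc i)))"
      unfolding T_def by (intro mult_left_mono) auto
    also have "\<dots> = (real (n choose Suc i) * p ^ Suc i) * (C * \<phi> (n - Suc i))"
      by (simp only: mult.assoc)
    also have "\<dots> \<le> peak n p * (C * \<phi> (n - Suc i))"
      using that p C \<phi> by (intro mult_right_mono binomial_times_power_le_peak) auto
    finally show ?thesis .
  qed
  have "expected_min_size n m p = (\<Sum>i\<le>n. T i)"
    using p by (simp add: expected_min_size_eq T_def q_def)
  also have "\<dots> = T 0 + (\<Sum>i<n. T (Suc i))" by (rule sum.atMost_shift)
  also have "\<dots> \<le> 1 + (\<Sum>i<n. peak n p * (C * \<phi> (n - Suc i)))"
    using T0 T by (intro add_mono sum_mono) auto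
  \<comment> \<open>Reversing the order of summation makes the arguments of \<open>\<phi>\<close>
    run through \<open>0, ..., n - 1\<close>.\<close>
  also have "(\<Sum>i<n. peak n p * (C * \<phi> (n - Suc i))) = peak n p * (C * (\<Sum>k<n. \<phi> k))"
    by (simp only: sum.nat_diff_reindex flip: sum_distrib_left)
  also have "\<dots> \<le> peak n p * (C * (2 / (1 - q)))"
    unfolding \<phi>_def using C q m peak_ge_1[OF p(1), of n]
    by (intro mult_left_mono sum_min_geometric_le) auto
  also have "1 + peak n p * (C * (2 / (1 - q))) \<le> peak n p + peak n p * (C * (2 / (1 - q)))"
    using peak_ge_1[OF p(1)] by simp
  also have "\<dots> = (1 + 4 * exp 1 / (p * (1 - p)\<^sup>2)) * peak n p"
    by (simp add: C_def q_def algebra_simps)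
  finally show ?thesis by simp
qed

text \<open>With \<open>r = p / (1 + p)\<close> the product equals
  \<open>q powr (n * r - i)\<close>, and the mode \<open>i\<close> is within distance 1 of
  \<open>n * r\<close>. This is what singles out the exponent \<open>n / (1 + p)\<close>.\<close>

lemma binomial_mode_critical_bounds:
  fixes p :: real and n :: nat
  defines "i \<equiv> binomial_mode n (p / (1 + p))"
  assumes p: "0 < p" "p < 1" and n: "n \<ge> 1"
  shows "i < n" "1 - p \<le> critical_m n p * (1 - p) ^ (n - i)" "critical_m n p * (1 - p) ^ (n - i) \<le> 1 / (1 - p)"
proof -
  define q where "q = 1 - p"
  have q: "0 < q" "q < 1" using p by (auto simp: q_def)
  define r where "r = p / (1 + p)"
  \<comment> \<open>From \<open>p < 1\<close> follows \<open>r < 1 / 2\<close>, which keeps the mode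
    strictly below \<open>n\<close> even for \<open>n = 1\<close>.\<close>
  have r: "0 < r" "r < 1 / 2" using p by (auto simp: r_def field_simps)
  have i: "real i \<le> (real n + 1) * r" "(real n + 1) * r < real i + 1"
    unfolding i_def r_def[symmetric] using r by (intro binomial_mode_bounds; simp)+
  have "(real n + 1) * r < (real n + 1) * (1 / 2)" using r by (intro mult_strict_left_mono) auto
  with i(1) have "real i < (real n + 1) * (1 / 2)" by (rule le_less_trans)
  then have "real i < real n" using n by simp
  then show "i < n" by simp
  have nr: "real n / (1 + p) = real n - real n * r" using p by (simp add: r_def field_simps)
  have "critical_m n p * q ^ (n - i) = q powr (- (real n / (1 + p))) * q powr (real n - real i)"
    using q \<open>i < n\<close> by (simp add: critical_m_def q_def[symmetric] powr_minus field_simps of_nat_diff flip: powr_realpow)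
  also have "\<dots> = q powr (real n * r - real i)"
    unfolding powr_add[symmetric] nr by simp
  finally have eq: "critical_m n p * q ^ (n - i) = q powr (real n * r - real i)" .
  have "q powr 1 \<le> q powr (real n * r - real i)"
    using q r i by (intro powr_mono') (auto simp: algebra_simps)
  then show "1 - p \<le> critical_m n p * (1 - p) ^ (n - i)"
    using q eq by (simp add: q_def)
  have "q powr (real n * r - real i) \<le> q powr (- 1)"
    using q r i by (intro powr_mono') (auto simp: algebra_simps)
  then show "critical_m n p * (1 - p) ^ (n - i) \<le> 1 / (1 - p)"
    using q eq by (simp add: q_def powr_minus field_simps)
qed

lemma expected_min_size_lower:
  assumes p: "0 < p" "p < 1" and n: "n \<ge> 1"
    and m: "m = nat \<lfloor>critical_m n p\<rfloor> \<or> m = nat \<lceil>critical_m n p\<rceil>"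
  shows "m \<ge> 1" "(1 - p) / 2 * exp (- 2 / (p * (1 - p))) * peak n p \<le> expected_min_size n m p"
proof -
  define q where "q = 1 - p"
  have q: "0 < q" "q < 1" using p by (auto simp: q_def)
  define c where "c = critical_m n p"
  have "q powr (real n / (1 + p)) \<le> q powr 0" using q p by (intro powr_mono') auto
  then have c: "1 \<le> c" using q by (simp add: c_def critical_m_def q_def)
  have m1: "m \<ge> 1" using m c unfolding c_def[symmetric] by linarith
  have "c - 1 \<le> real m" "real m \<le> c + 1" using m c unfolding c_def[symmetric] by linarith+
  \<comment> \<open>Since \<open>c \<ge> 1\<close>, rounding in either direction changes
    \<open>c\<close> by at most a factor 2.\<close>
  with m1 c have mc: "c / 2 \<le> real m" "real m \<le> 2 * c" by linarith+
  from m1 show "m \<ge> 1" .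
  define i where "i = binomial_mode n (p / (1 + p))"
  define a where "a = q ^ (n - i)"
  note crit = binomial_mode_critical_bounds[OF p n, folded i_def c_def q_def, folded a_def]
  \<comment> \<open>The strict bound \<open>i < n\<close> gives an exponent of at least 1, hence
    \<open>a \<le> q\<close>.\<close>
  have a: "0 < a" "a \<le> q"
    using q crit(1) power_decreasing[of 1 "n - i" q] by (auto simp: a_def)
  have "c / 2 * a \<le> real m * a" "real m * a \<le> 2 * c * a"
    using mc a by (auto intro!: mult_right_mono)
  with crit have ma: "q / 2 \<le> real m * a" "real m * a \<le> 2 / q" by auto
  define T where "T = (\<lambda>i. real (n choose i) * ((1 - q ^ (n - i) * (1 - p ^ i)) ^ m - (1 - q ^ (n - i)) ^ m))"
  have T_nonneg: "T j \<ge> 0" for j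
  proof -
    have "q ^ (n - j) * (1 - p ^ j) \<le> q ^ (n - j) * 1"
      using q p by (intro mult_left_mono) auto
    moreover have "q ^ (n - j) \<le> 1" using q by (simp add: power_le_one)
    ultimately have "(1 - q ^ (n - j)) ^ m \<le> (1 - q ^ (n - j) * (1 - p ^ j)) ^ m"
      by (intro power_mono) auto
    then show ?thesis by (simp add: T_def)
  qed
  have "peak n p = real (n choose i) * p ^ i"
    using binomial_times_power_eq_Bernstein[OF p(1), of i n] crit(1) by (simp add: peak_def i_def)
  then have "q / 2 * exp (- 2 / (p * q)) * peak n p =
        real (n choose i) * (p ^ i * (q / 2 * exp (- 2 / (p * q))))" by simp
  also have "\<dots> \<le> real (n choose i) * (p ^ i * ((real m * a) * exp (- (real m * a / (1 - q)))))"
  proof -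
    have "real m * a / (1 - q) \<le> (2 / q) / (1 - q)" using ma q by (intro divide_right_mono) auto
    then have "- 2 / (p * q) \<le> - (real m * a / (1 - q))" by (simp add: q_def mult.commute)
    then show ?thesis using ma p q by (intro mult_left_mono mult_mono) auto
  qed
  also have "\<dots> \<le> T i"
    using minimal_edge_term_lower[OF q a, of "p ^ i" m] p
    by (auto simp: T_def a_def mult.assoc power_le_one intro!: mult_left_mono)
  also have "\<dots> \<le> (\<Sum>j\<le>n. T j)"
    using T_nonneg crit(1) by (intro member_le_sum) auto
  also have "\<dots> = expected_min_size n m p"
    using p by (simp add: expected_min_size_eq T_def q_def)
  finally show "(1 - p) / 2 * exp (- 2 / (p * (1 - p))) * peak n p \<le> expected_min_size n m p"
    by (simp add: q_def)
qed

section \<open>Existence of the maximum over all sample counts\<close>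

text \<open>With many samples the empty set is eventually drawn and is then the only minimal edge.
  In the formula both powers vanish for \<open>i > 0\<close>, while for \<open>i = 0\<close> the
  first one is constantly 1.\<close>

lemma expected_min_size_tendsto:
  assumes p: "0 < p" "p < 1"
  shows "(\<lambda>m. expected_min_size n m p) \<longlonglongrightarrow> 1"
proof -
  define q where "q = 1 - p"
  have q: "0 < q" "q < 1" using p by (auto simp: q_def)
  define T where "T = (\<lambda>m i. real (n choose i) * ((1 - q ^ (n - i) * (1 - p ^ i)) ^ m - (1 - q ^ (n - i)) ^ m))"
  have pow0: "(\<lambda>m. (1 - q ^ k * b) ^ m) \<longlonglongrightarrow> 0" if "0 < b" "b \<le> 1" for k and b :: real
  proof (rule LIMSEQ_power_zero)
    have "0 < q ^ k * b" "q ^ k * b \<le> 1" using q that by (auto intro!: mult_le_one power_le_one)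
    then show "norm (1 - q ^ k * b) < 1" by simp
  qed
  have "(\<lambda>m. T m i) \<longlonglongrightarrow> (if i = 0 then 1 else 0)" for i
  proof (cases "i = 0")
    case True
    have "(\<lambda>m. 1 - (1 - q ^ n * 1) ^ m) \<longlonglongrightarrow> 1 - 0"
      by (intro tendsto_diff tendsto_const pow0) auto
    then show ?thesis using True by (simp add: T_def)
  next
    case False
    then have "p ^ i < 1" using p by (simp add: power_less_one_iff)
    then have "(\<lambda>m. T m i) \<longlonglongrightarrow> real (n choose i) * (0 - 0)"
      unfolding T_def using pow0[of 1 "n - i"] p
      by (intro tendsto_mult tendsto_diff tendsto_const pow0) auto
    then show ?thesis using False by simp
  qed
  then have "(\<lambda>m. \<Sum>i\<le>n. T m i) \<longlonglongrightarrow> (\<Sum>i\<le>n. if i = 0 then 1 else 0)"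
    by (intro tendsto_sum)
  then show ?thesis using p by (simp add: expected_min_size_eq T_def q_def)
qed

text \<open>A single sample is its own only minimal edge; the formula becomes the total binomial
  mass.\<close>

lemma expected_min_size_1:
  assumes "0 \<le> p" "p \<le> 1"
  shows "expected_min_size n 1 p = 1"
proof -
  have "expected_min_size n 1 p = (\<Sum>i\<le>n. Bernstein n i p)"
    using assms by (simp add: expected_min_size_eq Bernstein_def algebra_simps)
  then show ?thesis by simp
qed

text \<open>If some value exceeds the limit, a whole tail lies below that value and only finitely
  many candidates remain. Otherwise \<open>f m0\<close> is already largest.\<close>

lemma is_maximum_of_convergent:
  fixes f :: "nat \<Rightarrow> real"
  assumes "f \<longlonglongrightarrow> L" "f m0 \<ge> L" "m0 \<ge> 1"
  shows "\<exists>x. is_maximum {f m | m. m \<ge> 1} x"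
proof (cases "\<exists>m1\<ge>1. f m1 > L")
  case True
  then obtain m1 where m1: "m1 \<ge> 1" "f m1 > L" by auto
  with assms(1) have "eventually (\<lambda>m. f m < f m1) sequentially"
    by (auto dest: order_tendstoD(2))
  then obtain N where N: "\<And>m. m \<ge> N \<Longrightarrow> f m < f m1"
    by (auto simp: eventually_sequentially)
  let ?X = "f ` {1..max N m1}"
  have X: "finite ?X" "f m1 \<in> ?X" using m1 by auto
  have "is_maximum {f m | m. m \<ge> 1} (Max ?X)"
    unfolding is_maximum_def
  proof safe
    have "Max ?X \<in> ?X" using X by (intro Max_in) auto
    then show "\<exists>m. Max ?X = f m \<and> 1 \<le> m" by auto
  next
    fix m :: nat assume "1 \<le> m"
    show "f m \<le> Max ?X"
    proof (cases "m \<le> max N m1")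
      case True
      then show ?thesis using X \<open>1 \<le> m\<close> by (intro Max_ge) auto
    next
      case False
      then have "f m < f m1" by (intro N) auto
      also have "f m1 \<le> Max ?X" using X by (intro Max_ge)
      finally show ?thesis by simp
    qed
  qed
  then show ?thesis by blast
next
  case False
  then have "is_maximum {f m | m. m \<ge> 1} (f m0)"
    using assms by (force simp: is_maximum_def not_less)
  then show ?thesis by blast
qed

theorem theorem2:
  fixes p :: real
  assumes "0 \<le> p" and "p \<le> 1"
  shows "(p = 0 \<or> p = 1 \<longrightarrow>
           (\<forall>n\<ge>1. is_maximum
              {card (minimization H) | m H. m \<ge> 1 \<and> H \<in> set_pmf (random_multi_hypergraph n m p)} 1))
       \<and> (0 < p \<and> p < 1 \<longrightarrow>
           (\<exists>M :: nat \<Rightarrow> real.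
              (\<forall>n\<ge>1. is_maximum {expected_min_size n m p | m. m \<ge> 1} (M n))
            \<and> M \<in> \<Theta>(\<lambda>n. (1 + p) ^ n / sqrt (real n))
            \<and> (\<forall>\<mu> :: nat \<Rightarrow> nat.
                 (\<forall>n\<ge>1. \<mu> n = nat \<lfloor>critical_m n p\<rfloor> \<or> \<mu> n = nat \<lceil>critical_m n p\<rceil>)
                 \<longrightarrow> (\<lambda>n. expected_min_size n (\<mu> n) p) \<in> \<Theta>(M))))"
proof (rule conjI; rule impI)
  assume "p = 0 \<or> p = 1"
  then show "\<forall>n\<ge>1. is_maximum
      {card (minimization H) | m H. m \<ge> 1 \<and> H \<in> set_pmf (random_multi_hypergraph n m p)} 1"
    using card_minimization_degenerate by blast
next
  assume "0 < p \<and> p < 1"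
  then have p: "0 < p" "p < 1" by auto
  have "\<exists>x. is_maximum {expected_min_size n m p | m. m \<ge> 1} x" for n
    using expected_min_size_tendsto[OF p] expected_min_size_1[OF assms]
    by (intro is_maximum_of_convergent[of _ 1 1]) auto
  then obtain M where M: "\<And>n. is_maximum {expected_min_size n m p | m. m \<ge> 1} (M n)"
    by metis
  have M_ge: "expected_min_size n m p \<le> M n" if "m \<ge> 1" for n m
    using M[of n] that unfolding is_maximum_def by blast
  define K where "K = 1 + 4 * exp 1 / (p * (1 - p)\<^sup>2)"
  define c where "c = (1 - p) / 2 * exp (- 2 / (p * (1 - p)))"
  have c: "c > 0" using p by (simp add: c_def)
  have M_le: "M n \<le> K * peak n p" for n
    using M[of n] expected_min_size_upper[OF p] unfolding is_maximum_def K_def by auto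
  have pk: "0 \<le> peak n p" for n using peak_ge_1[OF p(1), of n] by simp
  have E_bigtheta: "(\<lambda>n. expected_min_size n (\<mu> n) p) \<in> \<Theta>(\<lambda>n. peak n p)"
    and M_bigtheta: "M \<in> \<Theta>(\<lambda>n. peak n p)"
    if \<mu>: "\<forall>n\<ge>1. \<mu> n = nat \<lfloor>critical_m n p\<rfloor> \<or> \<mu> n = nat \<lceil>critical_m n p\<rceil>" for \<mu>
  proof -
    \<comment> \<open>Anything between the expectation at \<open>\<mu> n\<close> and the maximum has
      the order of \<open>peak\<close>; both extremes are then instances.\<close>
    have sandwich: "f \<in> \<Theta>(\<lambda>n. peak n p)"
      if "\<And>n. n \<ge> 1 \<Longrightarrow> expected_min_size n (\<mu> n) p \<le> f n" "\<And>n. n \<ge> 1 \<Longrightarrow> f n \<le> M n" for f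
    proof -
      have low: "c * peak n p \<le> f n" if "n \<ge> 1" for n
        using expected_min_size_lower(2)[OF p that, of "\<mu> n"] \<mu> that
          \<open>n \<ge> 1 \<Longrightarrow> expected_min_size n (\<mu> n) p \<le> f n\<close> by (auto simp: c_def)
      have f0: "0 \<le> f n" if "n \<ge> 1" for n
        using low[OF that] c pk[of n] by (meson mult_nonneg_nonneg less_imp_le order_trans)
      have up: "f n \<le> K * peak n p" if "n \<ge> 1" for n
        using M_le[of n] \<open>n \<ge> 1 \<Longrightarrow> f n \<le> M n\<close> that by linarith
      show ?thesis
      proof
        show "f \<in> O(\<lambda>n. peak n p)"
          using up f0 pk by (intro bigoI[of _ K] eventually_mono[OF eventually_ge_at_top[of 1]]) auto
        show "f \<in> \<Omega>(\<lambda>n. peak n p)"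
          unfolding bigomega_iff_bigo using low f0 pk c
          by (intro bigoI[of _ "1 / c"] eventually_mono[OF eventually_ge_at_top[of 1]])
             (auto simp: field_simps)
      qed
    qed
    have \<mu>1: "expected_min_size n (\<mu> n) p \<le> M n" if "n \<ge> 1" for n
      using \<mu> that by (intro M_ge expected_min_size_lower(1)[OF p that]) auto
    show "(\<lambda>n. expected_min_size n (\<mu> n) p) \<in> \<Theta>(\<lambda>n. peak n p)" "M \<in> \<Theta>(\<lambda>n. peak n p)"
      using \<mu>1 by (auto intro: sandwich)
  qed
  have "M \<in> \<Theta>(\<lambda>n. peak n p)"
    \<comment> \<open>The claim on \<open>M\<close> does not mention \<open>\<mu>\<close>, so any
      admissible choice serves as witness.\<close>
    by (rule M_bigtheta[of "\<lambda>n. nat \<lfloor>critical_m n p\<rfloor>"]) simp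
  then have "M \<in> \<Theta>(\<lambda>n. (1 + p) ^ n / sqrt (real n))"
    using peak_bigtheta[OF p(1)] by (rule landau_theta.trans)
  moreover have "(\<lambda>n. expected_min_size n (\<mu> n) p) \<in> \<Theta>(M)"
    if "\<forall>n\<ge>1. \<mu> n = nat \<lfloor>critical_m n p\<rfloor> \<or> \<mu> n = nat \<lceil>critical_m n p\<rceil>" for \<mu>
    using E_bigtheta[OF that] M_bigtheta[OF that]
    by (metis bigtheta_sym landau_theta.trans)
  ultimately show "\<exists>M :: nat \<Rightarrow> real.
              (\<forall>n\<ge>1. is_maximum {expected_min_size n m p | m. m \<ge> 1} (M n))
            \<and> M \<in> \<Theta>(\<lambda>n. (1 + p) ^ n / sqrt (real n))
            \<and> (\<forall>\<mu> :: nat \<Rightarrow> nat.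
                 (\<forall>n\<ge>1. \<mu> n = nat \<lfloor>critical_m n p\<rfloor> \<or> \<mu> n = nat \<lceil>critical_m n p\<rceil>)
                 \<longrightarrow> (\<lambda>n. expected_min_size n (\<mu> n) p) \<in> \<Theta>(M))"
    using M by blast
qed

end
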